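(* Let $n\geq 5$ be an integer such that $4\nmid n$. Then the parameter set $t$-$(v,k,\lambda)$ with $t=4$, $v=\binom{n}{2}+2$, $k=n+1$, $\lambda=2$ is admissible, but there is no block design with these parameters.
   Context: A $t$-$(v,k,\lambda)$ (block) design is a set $D$ of $k$-element subsets (blocks) of a $v$-element set $V$ such that every $t$-element subset of $V$ is contained in exactly $\lambda$ blocks (blocks are not repeated). The parameter set $t$-$(v,k,\lambda)$ is admissible if $\lambda_i=\frac{\binom{v-i}{t-i}}{\binom{k-i}{t-i}}\lambda$ is an integer for all $i\in\{0,\ldots,t\}$. *)

theory Defs
  imports Complex_Main
begin

definition block_design :: "nat \<Rightarrow> nat \<Rightarrow> nat \<Rightarrow> nat \<Rightarrow> 'a set \<Rightarrow> 'a set set \<Rightarrow> bool" where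
  "block_design t v k l V D \<longleftrightarrow>
     finite V \<and> card V = v \<and>
     (\<forall>B\<in>D. B \<subseteq> V \<and> card B = k) \<and>
     (\<forall>T. T \<subseteq> V \<and> card T = t \<longrightarrow> card {B \<in> D. T \<subseteq> B} = l)"

text \<open>Meant for \<open>t \<le> k \<le> v\<close>: then the natural-number subtractions do not truncate and the
  denominator is nonzero. The quotient is taken in the rationals.\<close>

definition design_lambda :: "nat \<Rightarrow> nat \<Rightarrow> nat \<Rightarrow> nat \<Rightarrow> nat \<Rightarrow> rat" where
  "design_lambda t v k l i =
     of_nat ((v - i) choose (t - i)) / of_nat ((k - i) choose (t - i)) * of_nat l"

definition admissible :: "nat \<Rightarrow> nat \<Rightarrow> nat \<Rightarrow> nat \<Rightarrow> bool" where
  "admissible t v k l \<longleftrightarrow> (\<forall>i\<in>{0..t}. design_lambda t v k l i \<in> \<int>)"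

end

theory Submission
  imports Defs
begin

text \<open>The parameters are those of a tight 4-design: there are \<open>v choose 2\<close> blocks. For a block \<open>B\<close>
  of a 4-design, the average over all blocks \<open>B'\<close> of \<open>card (B \<inter> B') choose i\<close> is
  \<open>(k choose i)\<^sup>2 / (v choose i)\<close> for \<open>i \<le> 4\<close>, so the sum of \<open>q (card (B \<inter> B'))\<^sup>2\<close> is known for
  every quadratic \<open>q\<close>. If the design is tight and \<open>q\<close> is its Delsarte polynomial, the block
  \<open>B' = B\<close> alone contributes the whole sum, so \<open>q\<close> vanishes at the intersection sizes of distinct
  blocks. But \<open>\<lambda> = 2\<close> gives two distinct blocks with a common 4-set, while \<open>q\<close> is positive on
  \<open>{4..n}\<close>.\<close>

lemma card_supersets_with_card:
  assumes "finite B" "T \<subseteq> B" "card T \<le> t"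
  shows "card {S. T \<subseteq> S \<and> S \<subseteq> B \<and> card S = t} = (card B - card T) choose (t - card T)"
proof -
  have finT: "finite T" using assms finite_subset by blast
  have "bij_betw (\<lambda>R. T \<union> R) {R. R \<subseteq> B - T \<and> card R = t - card T}
      {S. T \<subseteq> S \<and> S \<subseteq> B \<and> card S = t}"
  proof (rule bij_betw_byWitness[where f' = "\<lambda>S. S - T"])
    have "card (T \<union> R) = t" if "R \<subseteq> B - T" "card R = t - card T" for R
    proof -
      have "finite R" using that(1) assms(1) finite_subset by blast
      then show ?thesis
        using that assms(3) finT by (subst card_Un_disjoint) auto
    qed
    then show "(\<lambda>R. T \<union> R) ` {R. R \<subseteq> B - T \<and> card R = t - card T}
        \<subseteq> {S. T \<subseteq> S \<and> S \<subseteq> B \<and> card S = t}"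
      using assms(2) by auto
    show "(\<lambda>S. S - T) ` {S. T \<subseteq> S \<and> S \<subseteq> B \<and> card S = t}
        \<subseteq> {R. R \<subseteq> B - T \<and> card R = t - card T}"
      using finT by (auto simp: card_Diff_subset)
  qed auto
  then have "card {S. T \<subseteq> S \<and> S \<subseteq> B \<and> card S = t} = card {R. R \<subseteq> B - T \<and> card R = t - card T}"
    by (simp add: bij_betw_same_card)
  also have "\<dots> = card (B - T) choose (t - card T)"
    using assms(1) by (intro n_subsets) simp
  finally show ?thesis using assms(2) finT by (simp add: card_Diff_subset)
qed

lemma block_designD:
  assumes "block_design t v k l V D"
  shows "finite V" "card V = v"
    and "\<And>B. B \<in> D \<Longrightarrow> B \<subseteq> V" "\<And>B. B \<in> D \<Longrightarrow> card B = k" "\<And>B. B \<in> D \<Longrightarrow> finite B"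
    and "\<And>T. T \<subseteq> V \<Longrightarrow> card T = t \<Longrightarrow> card {B \<in> D. T \<subseteq> B} = l"
  using assms unfolding block_design_def by (auto intro: finite_subset)

lemma block_design_finite: "block_design t v k l V D \<Longrightarrow> finite D"
  unfolding block_design_def by (meson Pow_iff finite_Pow_iff finite_subset subsetI)

lemma card_blocks_containing:
  assumes D: "block_design t v k l V D" and "t \<le> k" and T: "T \<subseteq> V" "card T \<le> t"
  shows "of_nat (card {B \<in> D. T \<subseteq> B}) = design_lambda t v k l (card T)"
proof -
  note design = block_designD[OF D]
  let ?E = "{B \<in> D. T \<subseteq> B}" and ?S = "{S. T \<subseteq> S \<and> S \<subseteq> V \<and> card S = t}"
  have extensions: "card {S \<in> ?S. S \<subseteq> B} = (k - card T) choose (t - card T)" if "B \<in> ?E" for B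
  proof -
    have "{S \<in> ?S. S \<subseteq> B} = {S. T \<subseteq> S \<and> S \<subseteq> B \<and> card S = t}"
      using that design(3) by blast
    then show ?thesis
      using that T(2) design(4,5) by (simp add: card_supersets_with_card)
  qed
  have blocks: "card {B \<in> ?E. S \<subseteq> B} = l" if "S \<in> ?S" for S
  proof -
    have "{B \<in> ?E. S \<subseteq> B} = {B \<in> D. S \<subseteq> B}" using that by blast
    then show ?thesis using that design(6) by simp
  qed
  have "((v - card T) choose (t - card T)) * l = (\<Sum>S\<in>?S. card {B \<in> ?E. S \<subseteq> B})"
    using blocks T design(1,2) by (simp add: card_supersets_with_card)
  also have "\<dots> = ((k - card T) choose (t - card T)) * card ?E"
    using extensions design(1) block_design_finite[OF D] by (intro sum_multicount) auto
  finally have "of_nat ((v - card T) choose (t - card T)) * of_nat l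
      = (of_nat ((k - card T) choose (t - card T)) * of_nat (card ?E) :: rat)"
    unfolding of_nat_mult[symmetric] by simp
  moreover have "(k - card T) choose (t - card T) \<noteq> 0"
    using \<open>t \<le> k\<close> by simp
  ultimately show ?thesis unfolding design_lambda_def by (simp add: field_simps)
qed

lemma card_blocks:
  assumes "block_design t v k l V D" "t \<le> k"
  shows "of_nat (card D) = design_lambda t v k l 0"
  using card_blocks_containing[OF assms, of "{}"] by simp

lemma sum_card_Int_choose:
  assumes D: "block_design t v k l V D" and "t \<le> k" "i \<le> t" and "U \<subseteq> V"
  shows "(\<Sum>B\<in>D. of_nat (card (U \<inter> B) choose i))
    = of_nat (card U choose i) * design_lambda t v k l i"
proof -
  have finU: "finite U" using block_designD(1)[OF D] \<open>U \<subseteq> V\<close> finite_subset by blast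
  let ?S = "{T. T \<subseteq> U \<and> card T = i}"
  have inside: "card {T \<in> ?S. T \<subseteq> B} = card (U \<inter> B) choose i" for B
  proof -
    have "{T \<in> ?S. T \<subseteq> B} = {T. T \<subseteq> U \<inter> B \<and> card T = i}" by auto
    then show ?thesis using n_subsets[of "U \<inter> B" i] finU by simp
  qed
  have "(\<Sum>B\<in>D. card (U \<inter> B) choose i) = (\<Sum>T\<in>?S. card {B \<in> D. T \<subseteq> B})"
    using finU block_design_finite[OF D] inside by (intro sum_multicount_gen[symmetric]) auto
  then have "(\<Sum>B\<in>D. of_nat (card (U \<inter> B) choose i))
      = (\<Sum>T\<in>?S. of_nat (card {B \<in> D. T \<subseteq> B}) :: rat)"
    unfolding of_nat_sum[symmetric] by simp
  also have "\<dots> = (\<Sum>T\<in>?S. design_lambda t v k l i)"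
    using card_blocks_containing[OF D \<open>t \<le> k\<close>] \<open>U \<subseteq> V\<close> \<open>i \<le> t\<close> by (intro sum.cong) auto
  finally show ?thesis using n_subsets[OF finU, of i] by simp
qed

lemma design_lambda_eq_design_lambda_0:
  assumes "i \<le> t" "t \<le> k" "t \<le> v"
  shows "design_lambda t v k l i
    = design_lambda t v k l 0 * of_nat (k choose i) / of_nat (v choose i)"
proof -
  have binomial_quotient: "of_nat ((m - i) choose (t - i))
      = (of_nat (m choose t) * of_nat (t choose i) / of_nat (m choose i) :: rat)" if "t \<le> m" for m
  proof -
    have "of_nat (m choose t) * of_nat (t choose i)
        = (of_nat (m choose i) * of_nat ((m - i) choose (t - i)) :: rat)"
      using choose_mult[OF \<open>i \<le> t\<close> that] by (metis of_nat_mult)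
    then show ?thesis using that \<open>i \<le> t\<close> by (simp add: field_simps)
  qed
  show ?thesis
    unfolding design_lambda_def binomial_quotient[OF \<open>t \<le> k\<close>] binomial_quotient[OF \<open>t \<le> v\<close>]
    using assms by (simp add: field_simps)
qed

lemma block_size_le:
  assumes "block_design t v k l V D" "B \<in> D"
  shows "k \<le> v"
  using block_designD(1-4)[OF assms(1)] assms(2) by (metis card_mono)

lemma sum_card_block_Int_choose:
  assumes D: "block_design t v k l V D" and "t \<le> k" "i \<le> t" and B: "B \<in> D"
  shows "(\<Sum>B'\<in>D. of_nat (card (B \<inter> B') choose i))
    = (of_nat (card D) * (of_nat (k choose i))\<^sup>2 / of_nat (v choose i) :: rat)"
  using sum_card_Int_choose[OF D \<open>t \<le> k\<close> \<open>i \<le> t\<close> block_designD(3)[OF D B]]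
    design_lambda_eq_design_lambda_0[OF \<open>i \<le> t\<close> \<open>t \<le> k\<close>, of v l] block_size_le[OF D B]
    block_designD(4)[OF D B] card_blocks[OF D \<open>t \<le> k\<close>] \<open>t \<le> k\<close>
  by (simp add: power2_eq_square)

lemma card_Int_blocks_less:
  assumes D: "block_design t v k l V D" and B: "B \<in> D" and C: "C \<in> D" and "B \<noteq> C"
  shows "card (B \<inter> C) < k"
proof -
  have "\<not> B \<subseteq> C"
    using card_subset_eq block_designD(4,5)[OF D] B C \<open>B \<noteq> C\<close> by metis
  then have "B \<inter> C \<subset> B" by blast
  then show ?thesis
    using psubset_card_mono block_designD(4,5)[OF D B] by metis
qed

lemma obtain_blocks_with_common_subset:
  assumes D: "block_design t v k l V D" and "t \<le> v" "2 \<le> l"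
  obtains B C where "B \<in> D" "C \<in> D" "B \<noteq> C" "t \<le> card (B \<inter> C)"
proof -
  note design = block_designD[OF D]
  obtain T where T: "T \<subseteq> V" "card T = t"
    using obtain_subset_with_card_n[of t V] design(2) \<open>t \<le> v\<close> by auto
  have "2 \<le> card {B \<in> D. T \<subseteq> B}" using design(6)[OF T] \<open>2 \<le> l\<close> by simp
  then obtain P where "P \<subseteq> {B \<in> D. T \<subseteq> B}" "card P = 2"
    using obtain_subset_with_card_n by metis
  then obtain B C where BC: "B \<in> D" "T \<subseteq> B" "C \<in> D" "T \<subseteq> C" "B \<noteq> C"
    by (auto simp: card_2_iff)
  then have "t \<le> card (B \<inter> C)"
    using card_mono[of "B \<inter> C" T] design(5) T(2) by simp
  with BC that show thesis by blast
qed

lemma gbinomial_2_3_4: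
  fixes x :: "'a :: field_char_0"
  shows "x gchoose 2 = x * (x - 1) / 2"
    and "x gchoose 3 = x * (x - 1) * (x - 2) / 6"
    and "x gchoose 4 = x * (x - 1) * (x - 2) * (x - 3) / 24"
  unfolding gbinomial_prod_rev by (simp_all add: eval_nat_numeral fact_numeral)

lemma gbinomial_quadratic_square:
  fixes a b c x :: "'a :: field_char_0"
  shows "(a + b * x + c * (x gchoose 2))\<^sup>2 = a\<^sup>2 * (x gchoose 0) + (2 * a * b + b\<^sup>2) * (x gchoose 1)
    + (2 * a * c + 2 * b\<^sup>2 + 4 * b * c + c\<^sup>2) * (x gchoose 2)
    + (6 * b * c + 6 * c\<^sup>2) * (x gchoose 3) + 6 * c\<^sup>2 * (x gchoose 4)"
  unfolding gbinomial_2_3_4 by (simp add: field_simps power2_eq_square)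

text \<open>Delsarte's quadratic in \<open>x\<close> for tight 4-\<open>(v, k, \<lambda>)\<close> designs, scaled to avoid denominators;
  \<open>\<lambda>\<close> is absent because tightness expresses it through \<open>v\<close> and \<open>k\<close>.\<close>

definition delsarte_poly :: "'a :: field_char_0 \<Rightarrow> 'a \<Rightarrow> 'a \<Rightarrow> 'a" where
  "delsarte_poly v k x = k * (k - 1)\<^sup>2 * (k - 2) - 2 * (v - 2) * (k - 1) * (k - 2) * x
     + 2 * (v - 2) * (v - 3) * (x gchoose 2)"

text \<open>Meaningful only for \<open>i \<le> 4\<close>.\<close>

definition delsarte_square_coeff :: "'a :: field_char_0 \<Rightarrow> 'a \<Rightarrow> nat \<Rightarrow> 'a" where
  "delsarte_square_coeff v k i =
    (let a = k * (k - 1)\<^sup>2 * (k - 2); b = - 2 * (v - 2) * (k - 1) * (k - 2);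
         c = 2 * (v - 2) * (v - 3)
     in [a\<^sup>2, 2 * a * b + b\<^sup>2, 2 * a * c + 2 * b\<^sup>2 + 4 * b * c + c\<^sup>2,
         6 * b * c + 6 * c\<^sup>2, 6 * c\<^sup>2] ! i)"

lemma delsarte_poly_square:
  "(delsarte_poly v k x)\<^sup>2 = (\<Sum>i\<le>4. delsarte_square_coeff v k i * (x gchoose i))"
proof -
  have "delsarte_poly v k x = k * (k - 1)\<^sup>2 * (k - 2) + (- 2 * (v - 2) * (k - 1) * (k - 2)) * x
      + (2 * (v - 2) * (v - 3)) * (x gchoose 2)"
    unfolding delsarte_poly_def by (simp add: algebra_simps)
  then show ?thesis
    by (simp only: gbinomial_quadratic_square)
      (simp add: delsarte_square_coeff_def Let_def eval_nat_numeral)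
qed

lemma sum_delsarte_square_coeff:
  fixes v k :: "'a :: field_char_0"
  assumes "v \<noteq> 0" "v \<noteq> 1" "v \<noteq> 2" "v \<noteq> 3"
  shows "(\<Sum>i\<le>4. delsarte_square_coeff v k i * ((v gchoose 2) * (k gchoose i)\<^sup>2 / (v gchoose i)))
    = (delsarte_poly v k k)\<^sup>2"
proof -
  define M where "M i = (v gchoose 2) * (k gchoose i)\<^sup>2 / (v gchoose i)" for i
  have M: "2 * M 0 = v * (v - 1)" "2 * M 1 = (v - 1) * k\<^sup>2" "4 * M 2 = (k * (k - 1))\<^sup>2"
    "12 * (v - 2) * M 3 = (k * (k - 1) * (k - 2))\<^sup>2"
    "48 * (v - 2) * (v - 3) * M 4 = (k * (k - 1) * (k - 2) * (k - 3))\<^sup>2"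
    using assms unfolding M_def gbinomial_2_3_4
    by (simp_all add: divide_simps power2_eq_square)
  have sum_M: "(\<Sum>i\<le>4. e i * M i) = e 0 * M 0 + e 1 * M 1 + e 2 * M 2 + e 3 * M 3 + e 4 * M 4"
    for e by (simp add: eval_nat_numeral)
  have "delsarte_poly v k k = k * (k - 1) * (v - k) * (v - k - 1)"
    unfolding delsarte_poly_def gbinomial_2_3_4 by (simp add: field_simps power2_eq_square)
  then show ?thesis
    unfolding M_def[symmetric] sum_M using M
    by (simp add: delsarte_square_coeff_def Let_def) algebra
qed

lemma sum_delsarte_poly_square:
  assumes D: "block_design 4 v k l V D" and "4 \<le> k" and tight: "card D = v choose 2"
    and B: "B \<in> D"
  shows "(\<Sum>B'\<in>D. (delsarte_poly (of_nat v) (of_nat k) (of_nat (card (B \<inter> B'))))\<^sup>2)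
    = (delsarte_poly (of_nat v) (of_nat k) (of_nat k) :: rat)\<^sup>2"
proof -
  define v' k' :: rat where "v' = of_nat v" and "k' = of_nat k"
  define s :: "'a set \<Rightarrow> rat" where "s B' = of_nat (card (B \<inter> B'))" for B'
  have "4 \<le> v'" using block_size_le[OF D B] \<open>4 \<le> k\<close> unfolding v'_def by simp
  have moment: "(\<Sum>B'\<in>D. s B' gchoose i) = (v' gchoose 2) * (k' gchoose i)\<^sup>2 / (v' gchoose i)"
    if "i \<le> 4" for i
    using sum_card_block_Int_choose[OF D \<open>4 \<le> k\<close> that B] tight
    by (simp add: s_def v'_def k'_def binomial_gbinomial)
  have "(\<Sum>B'\<in>D. (delsarte_poly v' k' (s B'))\<^sup>2)
      = (\<Sum>i\<le>4. delsarte_square_coeff v' k' i * (\<Sum>B'\<in>D. s B' gchoose i))"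
    unfolding delsarte_poly_square sum_distrib_left by (rule sum.swap)
  also have "\<dots> = (\<Sum>i\<le>4. delsarte_square_coeff v' k' i
      * ((v' gchoose 2) * (k' gchoose i)\<^sup>2 / (v' gchoose i)))"
    using moment by simp
  also have "\<dots> = (delsarte_poly v' k' k')\<^sup>2"
    using \<open>4 \<le> v'\<close> by (intro sum_delsarte_square_coeff) auto
  finally show ?thesis unfolding s_def v'_def k'_def .
qed

lemma delsarte_poly_card_Int_eq_0:
  assumes D: "block_design 4 v k l V D" and "4 \<le> k" and tight: "card D = v choose 2"
    and B: "B \<in> D" and C: "C \<in> D" and "B \<noteq> C"
  shows "delsarte_poly (of_nat v) (of_nat k) (of_nat (card (B \<inter> C))) = (0 :: rat)"
proof -
  let ?q = "\<lambda>B'. delsarte_poly (of_nat v) (of_nat k) (of_nat (card (B \<inter> B'))) :: rat"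
  have finD: "finite D" using D by (rule block_design_finite)
  have "(\<Sum>B'\<in>D. (?q B')\<^sup>2) = (?q B)\<^sup>2"
    using sum_delsarte_poly_square[OF D \<open>4 \<le> k\<close> tight B] block_designD(4)[OF D B] by simp
  then have "(\<Sum>B'\<in>D - {B}. (?q B')\<^sup>2) = 0"
    using sum.remove[OF finD B, of "\<lambda>B'. (?q B')\<^sup>2"] by simp
  then show ?thesis
    using sum_nonneg_eq_0_iff[of "D - {B}" "\<lambda>B'. (?q B')\<^sup>2"] finD C \<open>B \<noteq> C\<close> by auto
qed

lemma delsarte_poly_pos:
  fixes n x :: "'a :: linordered_field"
  assumes "2 < n" "4 \<le> x" "x < n + 1"
  shows "0 < delsarte_poly ((n gchoose 2) + 2) (n + 1) x"
proof -
  let ?m = "n gchoose 2"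
  have m: "?m = n * (n - 1) / 2" by (rule gbinomial_2_3_4)
  have "delsarte_poly (?m + 2) (n + 1) x
      = ?m / 2 * ((n - 2) * (n + 1) * (x - 1) * (x - 4) + 8 * (n + 1 - x))"
    unfolding delsarte_poly_def gbinomial_2_3_4 by (simp add: field_simps power2_eq_square)
  moreover have "0 < ?m / 2" using assms(1) unfolding m by simp
  moreover have "0 < (n - 2) * (n + 1) * (x - 1) * (x - 4) + 8 * (n + 1 - x)"
  proof (rule add_nonneg_pos)
    show "0 \<le> (n - 2) * (n + 1) * (x - 1) * (x - 4)"
      using assms by (intro mult_nonneg_nonneg) auto
  qed (use assms(3) in simp)
  ultimately show ?thesis by (simp only: mult_pos_pos)
qed

lemma le_choose_two:
  assumes "3 \<le> n"
  shows "n \<le> n choose 2"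
proof -
  have "n * 2 \<le> n * (n - 1)" using assms by (intro mult_le_mono2) simp
  then show ?thesis unfolding choose_two by linarith
qed

lemma design_lambda_0_choose_two_add_2:
  assumes "3 \<le> n"
  defines "v \<equiv> (n choose 2) + 2"
  shows "design_lambda 4 v (n + 1) 2 0 = of_nat (v choose 2)"
proof -
  define r :: rat where "r = of_nat n"
  have v: "of_nat v = r * (r - 1) / 2 + 2" and k: "of_nat (n + 1) = r + 1"
    unfolding v_def r_def by (simp_all add: binomial_gbinomial gbinomial_2_3_4)
  have "(of_nat v gchoose 4) * 2 = (of_nat v gchoose 2) * (r + 1 gchoose 4)"
    unfolding gbinomial_2_3_4 v by (simp add: field_simps)
  then have "of_nat (v choose 4) * 2 = (of_nat (v choose 2) * of_nat ((n + 1) choose 4) :: rat)"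
    unfolding binomial_gbinomial k .
  moreover have "(n + 1) choose 4 \<noteq> 0" using assms(1) by simp
  ultimately show ?thesis unfolding design_lambda_def by (simp add: field_simps)
qed

lemma design_lambda_choose_two_add_2:
  assumes "3 \<le> n"
  defines "v \<equiv> (n choose 2) + 2"
  defines "L \<equiv> design_lambda 4 v (n + 1) 2"
  shows "L 1 = of_nat ((n + 1) * ((n choose 2) + 1)) / 2"
    and "L 2 = of_nat ((n + 1) choose 2)"
    and "L 3 = of_nat (n + 1)"
proof -
  define r m :: rat where "r = of_nat n" and "m = of_nat (n choose 2)"
  have v: "of_nat v = m + 2" and k: "of_nat (n + 1) = r + 1"
    unfolding v_def m_def r_def by simp_all
  have m: "m = r * (r - 1) / 2"
    unfolding m_def r_def by (simp add: binomial_gbinomial gbinomial_2_3_4)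
  have "3 \<le> r" using assms(1) unfolding r_def by simp
  then have "0 < m" by (simp add: m)
  have "L i = L 0 * (r + 1 gchoose i) / (m + 2 gchoose i)" if "i \<le> 4" for i
    unfolding L_def v[symmetric] k[symmetric] binomial_gbinomial[symmetric]
    using that assms(1) le_choose_two[OF assms(1)]
    by (intro design_lambda_eq_design_lambda_0) (auto simp: v_def)
  moreover have "L 0 = (m + 2 gchoose 2)"
    using design_lambda_0_choose_two_add_2[OF assms(1), folded v_def]
    unfolding L_def binomial_gbinomial v .
  ultimately have ratio: "L i = (m + 2 gchoose 2) * (r + 1 gchoose i) / (m + 2 gchoose i)"
    if "i \<le> 4" for i
    using that by metis
  have "L 1 = (r + 1) * (m + 1) / 2"
    using ratio[of 1] \<open>0 < m\<close> unfolding gbinomial_2_3_4 by (simp del: distrib_left_numeral)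
  then show "L 1 = of_nat ((n + 1) * ((n choose 2) + 1)) / 2"
    unfolding r_def m_def by (simp add: algebra_simps)
  have "(m + 2 gchoose 2) \<noteq> 0" using \<open>0 < m\<close> unfolding gbinomial_2_3_4 by simp
  then have "L 2 = (r + 1 gchoose 2)" using ratio[of 2] by simp
  then show "L 2 = of_nat ((n + 1) choose 2)" unfolding binomial_gbinomial k .
  have "L 3 = (r + 1) * r * (r - 1) / (2 * m)"
    using ratio[of 3] \<open>0 < m\<close> unfolding gbinomial_2_3_4 by simp
  also have "\<dots> = r + 1" using \<open>3 \<le> r\<close> by (simp add: m)
  finally show "L 3 = of_nat (n + 1)" unfolding k .
qed

lemma odd_choose_two:
  assumes "even n" "\<not> 4 dvd n"
  shows "odd (n choose 2)"
proof -
  have "n mod 4 = 2" using assms by presburger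
  then obtain j where n: "n = 4 * j + 2" by (metis mult_div_mod_eq)
  then have "n choose 2 = (2 * j + 1) * (4 * j + 1)"
    by (simp add: choose_two algebra_simps)
  then show ?thesis by simp
qed

lemma admissible_choose_two_add_2:
  assumes "3 \<le> n" "\<not> 4 dvd n"
  shows "admissible 4 ((n choose 2) + 2) (n + 1) 2"
proof -
  let ?L = "design_lambda 4 ((n choose 2) + 2) (n + 1) 2"
  have "even ((n + 1) * ((n choose 2) + 1))"
    using odd_choose_two[OF _ assms(2)] by auto
  then have "?L 1 \<in> \<int>"
    unfolding design_lambda_choose_two_add_2[OF assms(1)] by (elim evenE) (simp del: of_nat_add)
  moreover have "?L 0 \<in> \<int>" "?L 2 \<in> \<int>" "?L 3 \<in> \<int>"
    unfolding design_lambda_0_choose_two_add_2[OF assms(1)]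
      design_lambda_choose_two_add_2[OF assms(1)] by (rule Ints_of_nat)+
  moreover have "?L 4 \<in> \<int>" by (simp add: design_lambda_def)
  moreover have "{0..4} = {0, 1, 2, 3, 4 :: nat}" by auto
  ultimately show ?thesis unfolding admissible_def by simp
qed

lemma no_block_design_choose_two_add_2:
  assumes "3 \<le> n"
  shows "\<not> block_design 4 ((n choose 2) + 2) (n + 1) 2 V D"
proof
  define v where "v = (n choose 2) + 2"
  assume "block_design 4 ((n choose 2) + 2) (n + 1) 2 V D"
  then have D: "block_design 4 v (n + 1) 2 V D" by (simp add: v_def)
  have "4 \<le> v" using le_choose_two[OF assms] assms unfolding v_def by linarith
  then obtain B C where BC: "B \<in> D" "C \<in> D" "B \<noteq> C" "4 \<le> card (B \<inter> C)"
    using obtain_blocks_with_common_subset[OF D] by auto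
  have "of_nat (card D) = (of_nat (v choose 2) :: rat)"
    using card_blocks[OF D] design_lambda_0_choose_two_add_2[OF assms] assms by (simp add: v_def)
  then have tight: "card D = v choose 2" by (rule of_nat_eq_iff[THEN iffD1])
  have "delsarte_poly (of_nat v) (of_nat (n + 1)) (of_nat (card (B \<inter> C))) = (0 :: rat)"
    using delsarte_poly_card_Int_eq_0[OF D _ tight BC(1-3)] assms by simp
  moreover have "0 < delsarte_poly (of_nat v) (of_nat (n + 1)) (of_nat (card (B \<inter> C)) :: rat)"
    using delsarte_poly_pos[of "of_nat n" "of_nat (card (B \<inter> C)) :: rat"] assms BC(4)
      card_Int_blocks_less[OF D BC(1-3)] by (simp add: v_def binomial_gbinomial add.commute)
  ultimately show False by simp
qed

theorem theorem3p3:
  fixes n :: nat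
  assumes "n \<ge> 5" and "\<not> 4 dvd n"
  shows "admissible 4 ((n choose 2) + 2) (n + 1) 2 \<and>
    \<not> (\<exists>(V :: 'a set) (D :: 'a set set). block_design 4 ((n choose 2) + 2) (n + 1) 2 V D)"
proof
  have "3 \<le> n" using assms(1) by simp
  then show "admissible 4 ((n choose 2) + 2) (n + 1) 2"
    using assms(2) by (rule admissible_choose_two_add_2)
  show "\<not> (\<exists>(V :: 'a set) D. block_design 4 ((n choose 2) + 2) (n + 1) 2 V D)"
    using no_block_design_choose_two_add_2[OF \<open>3 \<le> n\<close>] by blast
qed

end
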